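(* There is no uniquely $C_4^{+}$-saturated graph with exactly two triangles, and there is no uniquely $C_4^{+}$-saturated graph with exactly three triangles.
   Context: All graphs are finite, simple and undirected. $C_4^{+}$ (the diamond) is the graph obtained from a $4$-cycle by adding one chord, i.e. $K_4$ minus an edge. For a graph $H$, a graph $G$ is uniquely $H$-saturated if $G$ contains no subgraph isomorphic to $H$, but for every pair of non-adjacent vertices $u,v$ of $G$, the graph $G+uv$ contains exactly one subgraph isomorphic to $H$. A triangle is a subgraph isomorphic to $K_3$. *)

theory Defs
  imports Main
begin

text \<open>A graph is a pair of a vertex set and a set of edges, each edge being an unordered pair
  of distinct vertices.\<close>

type_synonym 'a graph = "'a set \<times> 'a set set"

abbreviation verts :: "'a graph \<Rightarrow> 'a set" where
  "verts G \<equiv> fst G"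

abbreviation edges :: "'a graph \<Rightarrow> 'a set set" where
  "edges G \<equiv> snd G"

definition simple_graph :: "'a graph \<Rightarrow> bool" where
  "simple_graph G \<longleftrightarrow> finite (verts G) \<and> (\<forall>e\<in>edges G. e \<subseteq> verts G \<and> card e = 2)"

definition subgraph :: "'a graph \<Rightarrow> 'a graph \<Rightarrow> bool" where
  "subgraph S G \<longleftrightarrow> simple_graph S \<and> verts S \<subseteq> verts G \<and> edges S \<subseteq> edges G"

definition isomorphic :: "'a graph \<Rightarrow> 'b graph \<Rightarrow> bool" where
  "isomorphic G H \<longleftrightarrow> (\<exists>f. bij_betw f (verts G) (verts H) \<and>
     (\<forall>u\<in>verts G. \<forall>v\<in>verts G. {u, v} \<in> edges G \<longleftrightarrow> {f u, f v} \<in> edges H))"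

text \<open>The subgraphs of \<open>G\<close> isomorphic to \<open>H\<close>, not necessarily induced; two of them may share
  their vertex set and differ only in their edges.\<close>

definition copies :: "'b graph \<Rightarrow> 'a graph \<Rightarrow> 'a graph set" where
  "copies H G = {S. subgraph S G \<and> isomorphic S H}"

definition add_edge :: "'a graph \<Rightarrow> 'a \<Rightarrow> 'a \<Rightarrow> 'a graph" where
  "add_edge G u v = (verts G, insert {u, v} (edges G))"

definition uniquely_saturated :: "'b graph \<Rightarrow> 'a graph \<Rightarrow> bool" where
  "uniquely_saturated H G \<longleftrightarrow> copies H G = {} \<and>
     (\<forall>u\<in>verts G. \<forall>v\<in>verts G. u \<noteq> v \<and> {u, v} \<notin> edges G \<longrightarrow>
        card (copies H (add_edge G u v)) = 1)"

definition K3 :: "nat graph" where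
  "K3 = ({0, 1, 2}, {{0, 1}, {1, 2}, {2, 0}})"

definition C4 :: "nat graph" where
  "C4 = ({0, 1, 2, 3}, {{0, 1}, {1, 2}, {2, 3}, {3, 0}})"

definition diamond :: "nat graph" where
  "diamond = add_edge C4 0 2"

end

theory Submission imports Defs begin

text \<open>
  Call an edge red if it lies in no triangle. For non-adjacent \<open>u\<close>, \<open>v\<close> there are, by counting the
  diamonds in \<open>G + uv\<close>, either exactly two common neighbours, joined to \<open>u\<close> and \<open>v\<close> by red edges
  only, or exactly one, joined by one red and one non-red edge. Hence triangles are
  vertex-disjoint, at most one edge runs between two triangles, and two vertices joined by a red
  path of length 2 are joined by exactly two of them. Consequently the ends of a red edge have the
  same red degree \<open>k\<close>, each reaches exactly \<open>k (k - 1) / 2\<close> vertices by red paths of length 2,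
  and so the numbers of remaining vertices (the set \<open>rest\<close>) agree.

  Given two triangles, label them \<open>abc\<close> and \<open>def\<close> so that no edge but possibly \<open>ad\<close> runs between
  them. The pairs \<open>be\<close>, \<open>bf\<close>, \<open>ce\<close>, \<open>cf\<close> have two common neighbours each, so \<open>rest b\<close> contains
  \<open>a\<close>, \<open>c\<close>, four neighbours of \<open>c\<close> and one of \<open>a\<close>. If there are at most three triangles, \<open>b\<close> has a
  neighbour \<open>v\<close> in no triangle, and \<open>rest v\<close> meets each triangle in at most two vertices and
  contains nothing else. This gives \<open>7 \<le> 6\<close>.
\<close>

section \<open>Copies of a graph as injective images\<close>

text \<open>The inverse of an isomorphism embeds \<open>H\<close> in \<open>G\<close>, and every
  such embedding has a copy as its image. This lets tuples of distinct vertices stand for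
  copies.\<close>

lemma copies_iff_inj_image:
  fixes H :: "'b graph" and G :: "'a graph"
  assumes H: "simple_graph H"
  shows "S \<in> copies H G \<longleftrightarrow> (\<exists>g. inj_on g (verts H) \<and> S = (g ` verts H, (`) g ` edges H) \<and>
      g ` verts H \<subseteq> verts G \<and> (`) g ` edges H \<subseteq> edges G)"
proof
  assume "S \<in> copies H G"
  then obtain f where sub: "subgraph S G" and f: "bij_betw f (verts S) (verts H)"
    and fe: "\<And>u v. u \<in> verts S \<Longrightarrow> v \<in> verts S \<Longrightarrow> {u, v} \<in> edges S \<longleftrightarrow> {f u, f v} \<in> edges H"
    unfolding copies_def isomorphic_def by blast
  define g where "g = inv_into (verts S) f"
  have g: "bij_betw g (verts H) (verts S)" unfolding g_def by (rule bij_betw_inv_into[OF f])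
  have gf: "g (f u) = u" if "u \<in> verts S" for u
    unfolding g_def using f that by (metis bij_betw_inv_into_left)
  have fg: "f (g p) = p" if "p \<in> verts H" for p
    unfolding g_def using f that by (metis bij_betw_inv_into_right)
  have gv: "g p \<in> verts S" if "p \<in> verts H" for p using g that by (metis bij_betwE)
  have ES: "edges S = (`) g ` edges H"
  proof (intro equalityI subsetI)
    fix e assume e: "e \<in> edges S"
    with sub have "e \<subseteq> verts S" "card e = 2" by (auto simp: subgraph_def simple_graph_def)
    then obtain u v where uv: "e = {u, v}" "u \<in> verts S" "v \<in> verts S"
      by (auto simp: card_2_iff)
    then have "{f u, f v} \<in> edges H" "g ` {f u, f v} = e" using fe e gf by auto
    then show "e \<in> (`) g ` edges H" by blast
  next
    fix e assume "e \<in> (`) g ` edges H"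
    then obtain d where d: "d \<in> edges H" "e = g ` d" by blast
    with H have "d \<subseteq> verts H" "card d = 2" by (auto simp: simple_graph_def)
    then obtain p q where pq: "d = {p, q}" "p \<in> verts H" "q \<in> verts H"
      by (auto simp: card_2_iff)
    then show "e \<in> edges S" using d fe[of "g p" "g q"] gv fg by auto
  qed
  show "\<exists>g. inj_on g (verts H) \<and> S = (g ` verts H, (`) g ` edges H) \<and>
      g ` verts H \<subseteq> verts G \<and> (`) g ` edges H \<subseteq> edges G"
    using g ES sub by (intro exI[of _ g]) (auto simp: bij_betw_def subgraph_def prod_eq_iff)
next
  assume "\<exists>g. inj_on g (verts H) \<and> S = (g ` verts H, (`) g ` edges H) \<and>
      g ` verts H \<subseteq> verts G \<and> (`) g ` edges H \<subseteq> edges G"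
  then obtain g where g: "inj_on g (verts H)" and S: "S = (g ` verts H, (`) g ` edges H)"
    and sub: "g ` verts H \<subseteq> verts G" "(`) g ` edges H \<subseteq> edges G" by blast
  have EV: "\<And>d. d \<in> edges H \<Longrightarrow> d \<subseteq> verts H \<and> card d = 2" and "finite (verts H)"
    using H by (auto simp: simple_graph_def)
  then have "simple_graph S"
    unfolding simple_graph_def S
    by (auto simp: card_image inj_on_subset[OF g])
  moreover have "isomorphic S H" unfolding isomorphic_def
  proof (intro exI conjI ballI)
    show "bij_betw (inv_into (verts H) g) (verts S) (verts H)"
      using g by (simp add: S bij_betw_inv_into inj_on_imp_bij_betw)
    fix u v assume "u \<in> verts S" "v \<in> verts S"
    then obtain p q where pq: "u = g p" "v = g q" "p \<in> verts H" "q \<in> verts H"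
      by (auto simp: S)
    have "{u, v} \<in> edges S \<longleftrightarrow> (\<exists>d\<in>edges H. g ` {p, q} = g ` d)"
      by (auto simp: S pq)
    \<comment> \<open>Since \<open>g\<close> is injective on \<open>verts H\<close>, an edge of
      \<open>H\<close> with the same image as \<open>{p, q}\<close> is \<open>{p, q}\<close>
      itself.\<close>
    also have "\<dots> \<longleftrightarrow> {p, q} \<in> edges H"
      using EV pq inj_on_image_eq_iff[OF g, of "{p, q}"] by auto
    finally show "{u, v} \<in> edges S \<longleftrightarrow>
        {inv_into (verts H) g u, inv_into (verts H) g v} \<in> edges H"
      using g pq by simp
  qed
  ultimately show "S \<in> copies H G" using sub by (simp add: copies_def subgraph_def S)
qed

definition diamond_on :: "'a \<Rightarrow> 'a \<Rightarrow> 'a \<Rightarrow> 'a \<Rightarrow> 'a graph" where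
  "diamond_on a b c d = ({a, b, c, d}, {{a, b}, {b, c}, {c, d}, {d, a}, {a, c}})"

definition triangle_on :: "'a \<Rightarrow> 'a \<Rightarrow> 'a \<Rightarrow> 'a graph" where
  "triangle_on a b c = ({a, b, c}, {{a, b}, {b, c}, {c, a}})"

text \<open>Needed to recover a copy of \<open>K3\<close> from its vertex set, so that triangles can
  be counted as vertex sets.\<close>

lemma edges_triangle_on:
  assumes "a \<noteq> b" "b \<noteq> c" "a \<noteq> c"
  shows "edges (triangle_on a b c) = {e. e \<subseteq> verts (triangle_on a b c) \<and> card e = 2}"
proof (intro equalityI subsetI)
  fix e assume "e \<in> {e. e \<subseteq> verts (triangle_on a b c) \<and> card e = 2}"
  then have "e \<subseteq> {a, b, c}" "card e = 2" by (simp_all add: triangle_on_def)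
  then obtain x y where "e = {x, y}" "x \<noteq> y" "x = a \<or> x = b \<or> x = c" "y = a \<or> y = b \<or> y = c"
    unfolding card_2_iff by blast
  then show "e \<in> edges (triangle_on a b c)"
    by (elim disjE) (simp_all add: triangle_on_def insert_commute)
qed (use assms in \<open>auto simp: triangle_on_def\<close>)

lemma diamond_eq: "diamond = diamond_on 0 1 2 3"
  by (auto simp: diamond_def C4_def add_edge_def diamond_on_def)

lemma copies_diamond_iff:
  assumes "simple_graph G"
  shows "S \<in> copies diamond G \<longleftrightarrow> (\<exists>a b c d. distinct [a, b, c, d] \<and> S = diamond_on a b c d \<and>
      {{a, b}, {b, c}, {c, d}, {d, a}, {a, c}} \<subseteq> edges G)" (is "_ \<longleftrightarrow> ?R")
proof -
  have "simple_graph diamond"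
    by (auto simp: simple_graph_def diamond_eq diamond_on_def)
  note iff = copies_iff_inj_image[OF this, of S G]
  show ?thesis
  proof
    assume "S \<in> copies diamond G"
    then obtain g where "inj_on g (verts diamond)"
      "S = (g ` verts diamond, (`) g ` edges diamond)" "(`) g ` edges diamond \<subseteq> edges G"
      using iff by blast
    then show ?R
      by (intro exI[of _ "g 0"] exI[of _ "g 1"] exI[of _ "g 2"] exI[of _ "g 3"])
        (auto simp: diamond_eq diamond_on_def)
  next
    assume ?R
    then obtain a b c d where *: "distinct [a, b, c, d]" "S = diamond_on a b c d"
      "{{a, b}, {b, c}, {c, d}, {d, a}, {a, c}} \<subseteq> edges G" by blast
    then have V: "{a, b, c, d} \<subseteq> verts G"
      using assms by (auto simp: simple_graph_def)
    show "S \<in> copies diamond G"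
      unfolding iff
      by (rule exI[of _ "\<lambda>n::nat. if n = 0 then a else if n = 1 then b else if n = 2 then c else d"])
        (use * V in \<open>auto simp: diamond_eq diamond_on_def inj_on_def insert_commute\<close>)
  qed
qed

lemma copies_K3_iff:
  assumes "simple_graph G"
  shows "S \<in> copies K3 G \<longleftrightarrow> (\<exists>a b c. distinct [a, b, c] \<and> S = triangle_on a b c \<and>
      {{a, b}, {b, c}, {c, a}} \<subseteq> edges G)" (is "_ \<longleftrightarrow> ?R")
proof -
  have "simple_graph K3"
    by (auto simp: simple_graph_def K3_def)
  note iff = copies_iff_inj_image[OF this, of S G]
  show ?thesis
  proof
    assume "S \<in> copies K3 G"
    then obtain g where "inj_on g (verts K3)"
      "S = (g ` verts K3, (`) g ` edges K3)" "(`) g ` edges K3 \<subseteq> edges G"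
      using iff by blast
    then show ?R
      by (intro exI[of _ "g 0"] exI[of _ "g 1"] exI[of _ "g 2"])
        (auto simp: K3_def triangle_on_def)
  next
    assume ?R
    then obtain a b c where *: "distinct [a, b, c]" "S = triangle_on a b c"
      "{{a, b}, {b, c}, {c, a}} \<subseteq> edges G" by blast
    then have V: "{a, b, c} \<subseteq> verts G"
      using assms by (auto simp: simple_graph_def)
    show "S \<in> copies K3 G"
      unfolding iff
      by (rule exI[of _ "\<lambda>n::nat. if n = 0 then a else if n = 1 then b else c"])
        (use * V in \<open>auto simp: K3_def triangle_on_def inj_on_def insert_commute\<close>)
  qed
qed

section \<open>Unique saturation as conditions on adjacency\<close>

text \<open>A diamond created by the edge \<open>uv\<close> has it either as chord, giving two
  common neighbours of \<open>u\<close> and \<open>v\<close>, or on the rim, giving a common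
  neighbour \<open>x\<close> with \<open>ux\<close> or \<open>xv\<close> in a triangle.
  \<open>saturated\<close> provides one such diamond. The three \<open>unique_\<close> assumptions
  exclude two different ones: both with chord \<open>uv\<close>, one of each kind, or both with
  \<open>uv\<close> on the rim at the same \<open>x\<close>.\<close>

locale diamond_saturated =
  fixes V :: "'a set" and adj :: "'a \<Rightarrow> 'a \<Rightarrow> bool"
  assumes finite_V: "finite V"
    and adj_in_V: "adj u v \<Longrightarrow> u \<in> V"
    and adj_sym: "adj u v \<Longrightarrow> adj v u"
    and adj_irrefl: "\<not> adj u u"
    and no_diamond: "adj x y \<Longrightarrow> adj x u \<Longrightarrow> adj y u \<Longrightarrow> adj x v \<Longrightarrow> adj y v \<Longrightarrow> u = v"
    and saturated: "u \<in> V \<Longrightarrow> v \<in> V \<Longrightarrow> u \<noteq> v \<Longrightarrow> \<not> adj u v \<Longrightarrow>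
      \<exists>x. adj u x \<and> adj x v \<and>
        ((\<exists>y. y \<noteq> x \<and> adj u y \<and> adj y v) \<or> (\<exists>p. adj u p \<and> adj x p) \<or> (\<exists>q. adj v q \<and> adj x q))"
    and unique_chord: "u \<noteq> v \<Longrightarrow> \<not> adj u v \<Longrightarrow> adj u x \<Longrightarrow> adj x v \<Longrightarrow> adj u y \<Longrightarrow> adj y v \<Longrightarrow>
      adj u z \<Longrightarrow> adj z v \<Longrightarrow> x = y \<or> y = z \<or> x = z"
    and unique_mixed: "u \<noteq> v \<Longrightarrow> \<not> adj u v \<Longrightarrow> adj u x \<Longrightarrow> adj x v \<Longrightarrow> adj u p \<Longrightarrow> adj x p \<Longrightarrow>
      adj u y \<Longrightarrow> adj y v \<Longrightarrow> x = y"
    and unique_rim: "u \<noteq> v \<Longrightarrow> \<not> adj u v \<Longrightarrow> adj u x \<Longrightarrow> adj x v \<Longrightarrow> adj u p \<Longrightarrow> adj x p \<Longrightarrow>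
      adj v q \<Longrightarrow> adj x q \<Longrightarrow> False"
begin

definition triangle :: "'a \<Rightarrow> 'a \<Rightarrow> 'a \<Rightarrow> bool" where
  "triangle a b c \<longleftrightarrow> adj a b \<and> adj b c \<and> adj a c"

definition triangles :: "'a set set" where
  "triangles = {{a, b, c} | a b c. triangle a b c}"

definition red :: "'a \<Rightarrow> 'a \<Rightarrow> bool" where
  "red u v \<longleftrightarrow> adj u v \<and> (\<forall>x. \<not> (adj u x \<and> adj v x))"

definition red1 :: "'a \<Rightarrow> 'a set" where
  "red1 u = {v. red u v}"

definition red2 :: "'a \<Rightarrow> 'a set" where
  "red2 u = {w. w \<noteq> u \<and> (\<exists>v. red u v \<and> red v w)}"

definition rest :: "'a \<Rightarrow> 'a set" where
  "rest u = V - ({u} \<union> red1 u \<union> red2 u)"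

section \<open>Red paths and the size of \<open>rest\<close>\<close>

lemma adj_in_V2: "adj u v \<Longrightarrow> v \<in> V"
  using adj_in_V adj_sym by blast

lemma red_sym: "red u v \<Longrightarrow> red v u"
  using adj_sym by (auto simp: red_def)

lemma red1_subset: "red1 u \<subseteq> V"
  using adj_in_V2 by (auto simp: red1_def red_def)

lemma red2_subset: "red2 u \<subseteq> V"
  using adj_in_V2 by (auto simp: red2_def red_def)

lemma finite_red1: "finite (red1 u)"
  using red1_subset finite_V by (rule finite_subset)

lemma finite_red2: "finite (red2 u)"
  using red2_subset finite_V by (rule finite_subset)

lemma red_path_not_adj: "red u v \<Longrightarrow> red v w \<Longrightarrow> \<not> adj u w"
  using adj_sym unfolding red_def by blast

text \<open>The middle vertex \<open>v\<close> alone closes no diamond with \<open>uw\<close>, as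
  neither of its edges lies in a triangle, so there is another common neighbour \<open>y\<close>. A
  triangle on \<open>uy\<close> or \<open>yw\<close> would contradict \<open>unique_mixed\<close>
  because of \<open>v\<close>, and a third common neighbour would contradict
  \<open>unique_chord\<close>.\<close>

lemma red_path_second:
  assumes "red u v" "red v w" "u \<noteq> w"
  obtains y where "y \<noteq> v" "red u y" "red y w"
    "\<And>x. adj u x \<Longrightarrow> adj x w \<Longrightarrow> x = v \<or> x = y"
proof -
  have n: "\<not> adj u w" "\<not> adj w u" using red_path_not_adj assms adj_sym by blast+
  have a: "adj u v" "adj v w" "adj w v" "adj v u" using assms adj_sym by (auto simp: red_def)
  obtain y where y: "y \<noteq> v" "adj u y" "adj y w"
  proof -
    obtain x where x: "adj u x" "adj x w"
      "(\<exists>y. y \<noteq> x \<and> adj u y \<and> adj y w) \<or> (\<exists>p. adj u p \<and> adj x p) \<or> (\<exists>q. adj w q \<and> adj x q)"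
      using saturated[OF _ _ \<open>u \<noteq> w\<close> n(1)] adj_in_V a by blast
    show ?thesis
    proof (cases "x = v")
      case True
      with x(3) assms(1,2) obtain y where "y \<noteq> v" "adj u y" "adj y w"
        using red_sym[OF assms(2)] unfolding red_def by blast
      then show ?thesis by (rule that)
    next
      case False
      then show ?thesis using that x by blast
    qed
  qed
  have "red u y"
    using unique_mixed[OF \<open>u \<noteq> w\<close> n(1) y(2,3) _ _ a(1,2)] y unfolding red_def by blast
  moreover have "red w y"
    using unique_mixed[OF \<open>u \<noteq> w\<close>[symmetric] n(2) adj_sym[OF y(3)] adj_sym[OF y(2)] _ _ a(3,4)]
      y adj_sym unfolding red_def by blast
  ultimately show ?thesis
    using that[of y] y(1) red_sym unique_chord[OF \<open>u \<noteq> w\<close> n(1) a(1,2) y(2,3)] y(1) by blast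
qed

text \<open>Each red path \<open>u v w\<close> has a second middle vertex \<open>h w\<close>, a red
  neighbour of \<open>u\<close>. The map \<open>h\<close> is injective because \<open>v\<close> and
  \<open>h w\<close> have only one common neighbour besides \<open>u\<close>.\<close>

lemma red_degree_le:
  assumes uv: "red u v"
  shows "card (red1 v - {u}) \<le> card (red1 u - {v})"
proof -
  define h where "h w = (SOME y. y \<noteq> v \<and> red u y \<and> red y w)" for w
  have h: "h w \<noteq> v \<and> red u (h w) \<and> red (h w) w" if "w \<in> red1 v - {u}" for w
  proof -
    have "\<exists>y. y \<noteq> v \<and> red u y \<and> red y w"
      using red_path_second[of u v w] uv that unfolding red1_def by blast
    then show ?thesis unfolding h_def by (rule someI_ex)
  qed
  have "inj_on h (red1 v - {u})"
  proof (rule inj_onI)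
    fix w w' assume w: "w \<in> red1 v - {u}" and w': "w' \<in> red1 v - {u}" and eq: "h w = h w'"
    note hw = h[OF w] and hw' = h[OF w', folded eq]
    \<comment> \<open>The red path from \<open>v\<close> through \<open>u\<close> to
      \<open>h w\<close>: both \<open>w\<close> and \<open>w'\<close> are common neighbours of its
      ends other than \<open>u\<close>.\<close>
    obtain y where "\<And>x. adj v x \<Longrightarrow> adj x (h w) \<Longrightarrow> x = u \<or> x = y"
      using red_path_second[of v u "h w"] red_sym[OF uv] hw by metis
    moreover have "adj v w" "adj v w'" "adj w (h w)" "adj w' (h w)"
      using w w' hw hw' adj_sym by (auto simp: red1_def red_def)
    ultimately show "w = w'" using w w' by blast
  qed
  moreover have "h ` (red1 v - {u}) \<subseteq> red1 u - {v}" using h by (auto simp: red1_def)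
  ultimately show ?thesis using finite_red1 by (intro card_inj_on_le) auto
qed

lemma red_degree_eq:
  assumes "red u v"
  shows "card (red1 u) = card (red1 v)"
proof -
  have "card (red1 v - {u}) = card (red1 u - {v})"
    using red_degree_le assms red_sym by (metis le_antisym)
  moreover have "u \<in> red1 v" "v \<in> red1 u" using assms red_sym by (auto simp: red1_def)
  ultimately show ?thesis
    using finite_red1 by (metis card.remove)
qed

text \<open>Red paths of length 2 from \<open>u\<close> are counted twice: by their end, which has
  two middle vertices, and by their middle vertex, which has the red degree of \<open>u\<close> and
  so continues to all of its red neighbours but \<open>u\<close>.\<close>

lemma card_red2: "2 * card (red2 u) = card (red1 u) * (card (red1 u) - 1)"
proof -
  have "(\<Sum>v\<in>red1 u. card {w \<in> red2 u. red v w}) = 2 * card (red2 u)"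
  proof (rule sum_multicount[OF finite_red1 finite_red2], rule ballI)
    fix w assume "w \<in> red2 u"
    then obtain v where v: "w \<noteq> u" "red u v" "red v w" by (auto simp: red2_def)
    then obtain y where y: "y \<noteq> v" "red u y" "red y w"
      "\<And>x. adj u x \<Longrightarrow> adj x w \<Longrightarrow> x = v \<or> x = y" using red_path_second by metis
    have "{v \<in> red1 u. red v w} = {v, y}"
    proof (intro equalityI subsetI)
      fix x assume "x \<in> {v \<in> red1 u. red v w}"
      then have "adj u x" "adj x w" by (simp_all add: red1_def red_def)
      then show "x \<in> {v, y}" using y(4) by blast
    qed (use v y(2,3) in \<open>auto simp: red1_def\<close>)
    then show "card {v \<in> red1 u. red v w} = 2" using y by simp
  qed
  moreover have "card {w \<in> red2 u. red v w} = card (red1 u) - 1" if "v \<in> red1 u" for v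
  proof -
    have "{w \<in> red2 u. red v w} = red1 v - {u}" "u \<in> red1 v" "red u v"
      using that red_sym by (auto simp: red1_def red2_def)
    then show ?thesis using red_degree_eq finite_red1 by simp
  qed
  ultimately show ?thesis by simp
qed

lemma card_rest:
  assumes "u \<in> V"
  shows "card (rest u) = card V - (1 + card (red1 u) + card (red2 u))"
proof -
  have "red1 u \<inter> red2 u = {}"
  proof (rule ccontr)
    assume "red1 u \<inter> red2 u \<noteq> {}"
    then obtain v w where "red u w" "red u v" "red v w" unfolding red1_def red2_def by blast
    then show False using red_path_not_adj unfolding red_def by blast
  qed
  moreover have "u \<notin> red1 u" using adj_irrefl[of u] by (simp add: red1_def red_def)
  moreover have "u \<notin> red2 u" by (simp add: red2_def)
  ultimately have "card ({u} \<union> red1 u \<union> red2 u) = 1 + card (red1 u) + card (red2 u)"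
    using finite_red1 finite_red2 by (simp add: card_Un_disjoint)
  then show ?thesis unfolding rest_def
    using assms red1_subset red2_subset finite_V finite_red1 finite_red2
    by (subst card_Diff_subset) auto
qed

lemma card_rest_eq:
  assumes "red u v"
  shows "card (rest u) = card (rest v)"
proof -
  have "u \<in> V" "v \<in> V" using assms adj_in_V adj_in_V2 by (auto simp: red_def)
  moreover have "2 * card (red2 u) = 2 * card (red2 v)"
    unfolding card_red2 red_degree_eq[OF assms] ..
  ultimately show ?thesis using red_degree_eq[OF assms] by (simp add: card_rest)
qed

section \<open>Disjointness of triangles\<close>

lemma triangle_sym:
  assumes "triangle a b c"
  shows "triangle b c a" "triangle a c b" "triangle b a c" "triangle c a b" "triangle c b a"
  using assms adj_sym by (auto simp: triangle_def)

lemma triangle_distinct: "triangle a b c \<Longrightarrow> a \<noteq> b \<and> b \<noteq> c \<and> a \<noteq> c"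
  using adj_irrefl by (auto simp: triangle_def)

lemma triangle_card: "T \<in> triangles \<Longrightarrow> card T = 3"
  using triangle_distinct by (auto simp: triangles_def)

lemma finite_triangles: "finite triangles"
proof (rule finite_subset)
  show "triangles \<subseteq> Pow V"
    using adj_in_V adj_in_V2 by (auto simp: triangles_def triangle_def)
qed (use finite_V in simp)

lemma triangle_mem:
  assumes "T \<in> triangles" "a \<in> T"
  obtains b c where "triangle a b c" "T = {a, b, c}"
proof -
  obtain x y z where "triangle x y z" "T = {x, y, z}" using assms by (auto simp: triangles_def)
  then show ?thesis
    using assms that[of y z] that[of x z] that[of x y] triangle_sym by blast
qed

text \<open>If two triangles met in one vertex \<open>a\<close>, a non-edge between them would have the common
  neighbour \<open>a\<close> with both connecting edges in triangles, hence close two diamonds.\<close>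

lemma triangle_at_unique:
  assumes abc: "triangle a b c" and ad: "adj a d" and dp: "adj a p" "adj d p"
  shows "d = b \<or> d = c"
proof (rule ccontr)
  assume "\<not> ?thesis"
  then have ne: "d \<noteq> b" "d \<noteq> c" by auto
  have a: "adj a b" "adj b c" "adj a c" "adj b a" using abc adj_sym by (auto simp: triangle_def)
  have "adj b d"
  proof (rule ccontr)
    assume "\<not> adj b d"
    then show False
      using unique_rim[of b d a c p] ne a ad dp by (metis)
  qed
  then show False using no_diamond[of a b c d] a ad ne by blast
qed

lemma triangles_disjoint:
  assumes "S \<in> triangles" "T \<in> triangles" "a \<in> S" "a \<in> T"
  shows "S = T"
proof -
  obtain b c where S: "triangle a b c" "S = {a, b, c}" using triangle_mem assms by metis
  obtain d e where T: "triangle a d e" "T = {a, d, e}" using triangle_mem assms by metis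
  have "d = b \<or> d = c" "e = b \<or> e = c"
    using triangle_at_unique[OF S(1), of d e] triangle_at_unique[OF S(1), of e d]
      T(1) adj_sym by (auto simp: triangle_def)
  moreover have "d \<noteq> e" using triangle_distinct T by blast
  ultimately show ?thesis using S T by auto
qed

section \<open>Upper bound for \<open>rest\<close> at a vertex in no triangle\<close>

text \<open>All edges at \<open>v\<close> are red, so \<open>w\<close> is not adjacent to
  \<open>v\<close> and they have a common neighbour \<open>x\<close>. If \<open>xw\<close> were red
  too, \<open>w\<close> would lie in \<open>red2 v\<close>.\<close>

lemma rest_of_non_triangle_vertex:
  assumes v: "v \<in> V" and out: "v \<notin> \<Union> triangles" and w: "w \<in> rest v"
  obtains x p where "adj v x" "triangle x w p"
proof -
  have red_v: "red v x" if "adj v x" for x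
    using that out unfolding red_def triangles_def triangle_def by blast
  have w': "w \<in> V" "w \<noteq> v" "\<not> red v w" "w \<notin> red2 v" using w by (auto simp: rest_def red1_def)
  then have "\<not> adj v w" using red_v by blast
  then obtain x where x: "adj v x" "adj x w"
    using saturated[of v w] v w' by blast
  then have "\<not> red x w" using w' red_v by (auto simp: red2_def)
  then obtain p where "adj x p" "adj w p" using x by (auto simp: red_def)
  then show ?thesis using that[of x p] x by (auto simp: triangle_def)
qed

text \<open>A triangle that meets \<open>rest v\<close> also contains a red neighbour of
  \<open>v\<close>, which is not in \<open>rest v\<close>. Hence it contributes at most two
  vertices.\<close>

lemma card_rest_le:
  assumes v: "v \<in> V" and out: "v \<notin> \<Union> triangles"
  shows "card (rest v) \<le> 2 * card triangles"
proof -
  have "rest v \<subseteq> (\<Union>T\<in>triangles. rest v \<inter> T)"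
  proof
    fix w assume w: "w \<in> rest v"
    obtain x p where "triangle x w p" using rest_of_non_triangle_vertex[OF v out w] .
    then have "{x, w, p} \<in> triangles" by (auto simp: triangles_def)
    then show "w \<in> (\<Union>T\<in>triangles. rest v \<inter> T)" using w by blast
  qed
  then have "card (rest v) \<le> card (\<Union>T\<in>triangles. rest v \<inter> T)"
    by (rule card_mono[rotated]) (use finite_triangles finite_V in \<open>auto simp: rest_def\<close>)
  also have "\<dots> \<le> (\<Sum>T\<in>triangles. card (rest v \<inter> T))"
    by (rule card_UN_le[OF finite_triangles])
  also have "\<dots> \<le> (\<Sum>T\<in>triangles. 2)"
  proof (rule sum_mono)
    fix T assume T: "T \<in> triangles"
    then have T3: "card T = 3" by (rule triangle_card)
    then have "finite T" by (metis card.infinite zero_neq_numeral)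
    show "card (rest v \<inter> T) \<le> 2"
    proof (cases "rest v \<inter> T = {}")
      case False
      then obtain w where w: "w \<in> rest v" "w \<in> T" by blast
      obtain x p where x: "adj v x" "triangle x w p"
        using rest_of_non_triangle_vertex[OF v out w(1)] .
      then have "{x, w, p} \<in> triangles" by (auto simp: triangles_def)
      \<comment> \<open>Both triangles contain \<open>w\<close>, so they coincide.\<close>
      then have "x \<in> T" using triangles_disjoint[OF _ T, of "{x, w, p}" w] w by blast
      moreover have "red v x"
        using x out unfolding red_def triangles_def triangle_def by blast
      then have "x \<notin> rest v" by (auto simp: rest_def red1_def)
      ultimately have "rest v \<inter> T \<subset> T" by blast
      then have "card (rest v \<inter> T) < card T" by (rule psubset_card_mono[OF \<open>finite T\<close>])
      then show ?thesis using T3 by simp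
    qed simp
  qed
  finally show ?thesis by simp
qed

section \<open>Two triangles with at most one edge between them\<close>

lemma triangle_nbr_unique:
  assumes "triangle a b c" "adj x a" "adj x b"
  shows "x = c"
  using no_diamond[of a b x c] assms adj_sym by (auto simp: triangle_def)

text \<open>The path \<open>b a x\<close> has its edge \<open>ba\<close> in a triangle, so by
  \<open>unique_mixed\<close> \<open>a\<close> is the only common neighbour of \<open>b\<close> and
  \<open>x\<close>. A red path from \<open>b\<close> to \<open>x\<close> would have to pass through
  \<open>a\<close>, but \<open>ba\<close> is not red.\<close>

lemma in_rest_of_triangle_nbr:
  assumes abc: "triangle a b c" and ax: "adj a x" and x: "x \<noteq> b" "x \<noteq> c"
  shows "x \<in> rest b"
proof -
  have a: "adj a b" "adj b c" "adj a c" "adj b a" "adj c a"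
    using abc adj_sym by (auto simp: triangle_def)
  have "\<not> adj b x"
    using triangle_nbr_unique[OF abc, of x] ax x adj_sym by blast
  moreover have "x \<notin> red2 b"
  proof
    assume "x \<in> red2 b"
    then obtain v where v: "red b v" "red v x" by (auto simp: red2_def)
    then have "a = v"
      using unique_mixed[of b x a c v] \<open>\<not> adj b x\<close> a ax x adj_sym unfolding red_def by metis
    then show False using v(1) a adj_sym unfolding red_def by blast
  qed
  ultimately show ?thesis
    using x ax adj_in_V2 by (auto simp: rest_def red1_def red_def)
qed

text \<open>Adjacency does not exclude \<open>a\<close> from \<open>rest b\<close>: the edge
  \<open>ab\<close> is not red, and the ends of a red path of length 2 are never adjacent.\<close>

lemma triangle_vertex_in_rest:
  assumes abc: "triangle a b c"
  shows "a \<in> rest b"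
proof -
  have a: "adj a b" "adj b c" "adj a c" "adj b a" "adj c a"
    using abc adj_sym by (auto simp: triangle_def)
  have "\<not> red b a" using a unfolding red_def by blast
  moreover have "a \<notin> red2 b" using a(4) unfolding red2_def by (blast dest: red_path_not_adj)
  ultimately show ?thesis
    using adj_in_V[OF a(1)] adj_irrefl[of b] a(4) by (auto simp: rest_def red1_def)
qed

text \<open>The excluded edges keep every common neighbour \<open>x\<close> of \<open>b\<close> and
  \<open>e\<close> off both triangles. As \<open>b\<close> and \<open>e\<close> lie in no other
  triangle, \<open>bx\<close> and \<open>xe\<close> lie in none, and only the chord case of
  \<open>saturated\<close> remains.\<close>

lemma two_common_nbrs:
  assumes abc: "triangle a b c" and "triangle d e f"
    and "b \<noteq> e" "\<not> adj b e" "\<not> adj a e" "\<not> adj c e" "\<not> adj b d" "\<not> adj b f"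
  obtains x y where "x \<noteq> y" "adj b x" "adj x e" "adj b y" "adj y e"
proof -
  have V: "b \<in> V" "e \<in> V" using assms adj_in_V adj_in_V2 by (auto simp: triangle_def)
  obtain x where x: "adj b x" "adj x e" and
    "(\<exists>y. y \<noteq> x \<and> adj b y \<and> adj y e) \<or> (\<exists>p. adj b p \<and> adj x p) \<or> (\<exists>q. adj e q \<and> adj x q)"
    using saturated[OF V \<open>b \<noteq> e\<close> \<open>\<not> adj b e\<close>] by blast
  moreover have "\<not> (adj b p \<and> adj x p)" for p
    using triangle_at_unique[OF triangle_sym(3)[OF abc] x(1)] assms x by blast
  moreover have "\<not> (adj e q \<and> adj x q)" for q
    using triangle_at_unique[OF triangle_sym(3)[OF assms(2)] adj_sym[OF x(2)]] assms x by blast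
  ultimately show ?thesis using that x by metis
qed

lemma almost_nonadjacent_triangles:
  assumes abc: "triangle a b c" and def: "triangle d e f"
    and disj: "{a, b, c} \<inter> {d, e, f} = {}"
    and le3: "card triangles \<le> 3"
    and b: "\<not> adj b d" "\<not> adj b e" "\<not> adj b f"
    and c: "\<not> adj c d" "\<not> adj c e" "\<not> adj c f"
    and a: "\<not> adj a e" "\<not> adj a f"
  shows False
proof -
  let ?T1 = "{a, b, c}" and ?T2 = "{d, e, f}"
  have T: "?T1 \<in> triangles" "?T2 \<in> triangles" using abc def by (auto simp: triangles_def)
  have dist: "a \<noteq> b" "b \<noteq> c" "a \<noteq> c" using triangle_distinct[OF abc] by auto
  obtain x y where xy: "x \<noteq> y" "adj b x" "adj x e" "adj b y" "adj y e"
    using two_common_nbrs[OF abc def] disj a b c by auto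
  obtain s t where st: "s \<noteq> t" "adj c s" "adj s e" "adj c t" "adj t e"
    using two_common_nbrs[OF triangle_sym(2)[OF abc] def] disj a b c by auto
  obtain p q where pq: "p \<noteq> q" "adj c p" "adj p f" "adj c q" "adj q f"
    using two_common_nbrs[OF triangle_sym(2)[OF abc] triangle_sym(2)[OF def]] disj a b c by auto
  \<comment> \<open>The element of \<open>rest b\<close> contributed by \<open>a\<close>: its
    neighbour \<open>d\<close> if they are adjacent, otherwise a common neighbour of
    \<open>a\<close> and \<open>e\<close>.\<close>
  obtain z where z: "adj a z" "z \<noteq> b" "z \<noteq> c"
  proof (cases "adj a d")
    case True
    then show ?thesis using that[of d] disj by auto
  next
    case False
    then obtain x y where "x \<noteq> y" "adj a x" "adj x e" "adj a y" "adj y e"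
      using two_common_nbrs[OF triangle_sym(3)[OF abc] def] disj a b c by auto
    then show ?thesis using that[of x] b c by blast
  qed
  \<comment> \<open>A vertex adjacent to both \<open>e\<close> and \<open>f\<close> must be
    \<open>d\<close>, which is not adjacent to \<open>c\<close>. So \<open>s\<close>,
    \<open>t\<close> differ from \<open>p\<close>, \<open>q\<close>.\<close>
  have ef: "w \<noteq> w'" if "adj c w" "adj w e" "adj w' f" for w w'
    using triangle_nbr_unique[OF triangle_sym(1)[OF def], of w] that c by blast
  have distinct: "distinct [s, t, p, q]" using ef st pq by auto
  have out: "w \<notin> {a, b, c}" if "adj c w" "adj w e \<or> adj w f" for w
    using that a b c by auto
  have cw: "w \<in> rest b" "w \<noteq> a" "w \<noteq> c" "w \<noteq> z" if "w \<in> {s, t, p, q}" for w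
  proof -
    have w: "adj c w" "w \<notin> {a, b, c}" using that out st pq by auto
    then show "w \<in> rest b" "w \<noteq> a" "w \<noteq> c"
      using in_rest_of_triangle_nbr[OF triangle_sym(5)[OF abc]] by auto
    \<comment> \<open>A vertex adjacent to both \<open>a\<close> and \<open>c\<close> must be
      \<open>b\<close>.\<close>
    show "w \<noteq> z" using triangle_nbr_unique[OF triangle_sym(2)[OF abc], of w] w z adj_sym by blast
  qed
  have "{a, c, z, s, t, p, q} \<subseteq> rest b"
    using cw(1) in_rest_of_triangle_nbr[OF abc z] triangle_vertex_in_rest[OF abc]
      triangle_vertex_in_rest[OF triangle_sym(5)[OF abc]] by simp
  moreover have "card {a, c, z, s, t, p, q} = 7"
  proof -
    have "z \<noteq> a" using z adj_irrefl by blast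
    then have "distinct [a, c, z, s, t, p, q]"
      using distinct dist z(3) cw(2-4)[of s] cw(2-4)[of t] cw(2-4)[of p] cw(2-4)[of q] by simp
    from distinct_card[OF this] show ?thesis by simp
  qed
  moreover have "finite (rest b)" using finite_V by (simp add: rest_def)
  ultimately have seven: "7 \<le> card (rest b)" by (metis card_mono)
  \<comment> \<open>One of \<open>x\<close>, \<open>y\<close> will do. Otherwise both lie in
    triangles other than the two given ones, and these are the same triangle because there are at
    most three.\<close>
  have "\<exists>v. adj b v \<and> v \<notin> \<Union> triangles"
  proof (rule ccontr)
    assume "\<not> ?thesis"
    then obtain X Y where X: "X \<in> triangles" "x \<in> X" and Y: "Y \<in> triangles" "y \<in> Y"
      using xy by blast
    have notin: "w \<notin> ?T1 \<and> w \<notin> ?T2" if "adj b w" "adj w e" for w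
      using that a b c by auto
    have ne: "X \<noteq> ?T1" "X \<noteq> ?T2" "Y \<noteq> ?T1" "Y \<noteq> ?T2" using notin X Y xy by blast+
    have "X = Y"
    proof (rule ccontr)
      assume "X \<noteq> Y"
      have card4: "card {A, B, C, D} = 4"
        if "A \<noteq> B" "C \<noteq> A" "C \<noteq> B" "D \<noteq> A" "D \<noteq> B" "C \<noteq> D" for A B C D :: "'a set"
        using that by auto
      have "?T1 \<noteq> ?T2" using disj by blast
      then have "card {?T1, ?T2, X, Y} = 4" using ne \<open>X \<noteq> Y\<close> by (rule card4)
      moreover have "card {?T1, ?T2, X, Y} \<le> card triangles"
        using T X Y finite_triangles by (intro card_mono) auto
      ultimately show False using le3 by simp
    qed
    obtain y' z' where X': "triangle x y' z'" "X = {x, y', z'}" using triangle_mem X by metis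
    then have "y = y' \<or> y = z'" using Y \<open>X = Y\<close> xy(1) by blast
    then obtain r where r: "triangle x y r" "X = {x, y, r}"
    proof
      assume "y = z'"
      then show ?thesis using that[of y'] X' triangle_sym(2)[OF X'(1)] by (simp add: insert_commute)
    qed (use that[of z'] X' in simp)
    \<comment> \<open>Being adjacent to \<open>x\<close> and \<open>y\<close>, \<open>b\<close> is
      the third vertex of their triangle, which is disjoint from the triangle of
      \<open>b\<close>.\<close>
    have "b = r" using triangle_nbr_unique[OF r(1)] xy by blast
    then show False using triangles_disjoint[OF X(1) T(1), of b] r(2) ne(1) by blast
  qed
  then obtain v where v: "adj b v" "v \<notin> \<Union> triangles" by blast
  have "red b v"
    using v unfolding red_def triangles_def triangle_def by blast
  then have "7 \<le> card (rest v)" using seven card_rest_eq by simp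
  also have "\<dots> \<le> 2 * card triangles" using card_rest_le v adj_in_V2 by blast
  finally show False using le3 by simp
qed

text \<open>An edge \<open>ae\<close> or \<open>bd\<close> would complete a diamond with one of the
  triangles. With \<open>be\<close>, the non-adjacent \<open>a\<close> and \<open>e\<close> would
  have the common neighbours \<open>b\<close> and \<open>d\<close>, although \<open>ab\<close> lies
  in a triangle.\<close>

lemma edge_between_triangles_unique:
  assumes abc: "triangle a b c" and def: "triangle d e f"
    and disj: "{a, b, c} \<inter> {d, e, f} = {}"
    and ad: "adj a d"
  shows "\<not> adj a e" "\<not> adj b d" "\<not> adj b e"
proof -
  show ae: "\<not> adj a e" using triangle_nbr_unique[OF def, of a] ad disj by auto
  show "\<not> adj b d" using triangle_nbr_unique[OF abc, of d] ad adj_sym disj by auto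
  show "\<not> adj b e"
  proof
    assume "adj b e"
    then have "b = d"
      using unique_mixed[of a e b c d] ae abc def ad disj adj_sym
      by (auto simp: triangle_def)
    then show False using disj by auto
  qed
qed

lemma card_triangles:
  assumes "2 \<le> card triangles" "card triangles \<le> 3"
  shows False
proof -
  obtain S T where ST: "S \<in> triangles" "T \<in> triangles" "S \<noteq> T"
    using assms(1) by (metis card_le_Suc0_iff_eq finite_triangles not_less_eq_eq numeral_2_eq_2)
  then have disj: "S \<inter> T = {}" using triangles_disjoint by blast
  show False
  proof (cases "\<exists>a\<in>S. \<exists>d\<in>T. adj a d")
    case True
    then obtain a d where ad: "a \<in> S" "d \<in> T" "adj a d" by blast
    obtain b c where S: "triangle a b c" "S = {a, b, c}" using triangle_mem ST ad by metis
    obtain e f where T: "triangle d e f" "T = {d, e, f}" using triangle_mem ST ad by metis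
    \<comment> \<open>Swapping \<open>b\<close> with \<open>c\<close> and \<open>e\<close> with
      \<open>f\<close> makes the four instances below exclude all eight pairs other than
      \<open>ad\<close>.\<close>
    have S': "triangle a c b" and T': "triangle d f e" using S T triangle_sym by blast+
    note uniq = edge_between_triangles_unique[OF _ _ _ ad(3)]
    show False
      using almost_nonadjacent_triangles[OF S(1) T(1) _ assms(2)] disj S T
        uniq[OF S(1) T(1)] uniq[OF S' T(1)] uniq[OF S(1) T'] uniq[OF S' T']
      by (simp add: insert_commute)
  next
    case False
    obtain a b c where S: "triangle a b c" "S = {a, b, c}" using ST by (auto simp: triangles_def)
    obtain d e f where T: "triangle d e f" "T = {d, e, f}" using ST by (auto simp: triangles_def)
    show False
      using almost_nonadjacent_triangles[OF S(1) T(1) _ assms(2)] disj S T False by simp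
  qed
qed

end

section \<open>From unique saturation to the adjacency conditions\<close>

lemma uniquely_saturated_imp_locale:
  assumes G: "simple_graph G" and sat: "uniquely_saturated diamond G"
  shows "diamond_saturated (verts G) (\<lambda>u v. {u, v} \<in> edges G)"
proof -
  define adj where "adj u v \<longleftrightarrow> {u, v} \<in> edges G" for u v
  have sym: "adj u v \<longleftrightarrow> adj v u" for u v by (simp add: adj_def insert_commute)
  have irr: "\<not> adj u u" for u
    using G by (auto simp: adj_def simple_graph_def)
  have inV: "adj u v \<Longrightarrow> u \<in> verts G" for u v
    using G by (auto simp: adj_def simple_graph_def)
  have none: "\<not> (distinct [a, b, c, d] \<and> adj a b \<and> adj b c \<and> adj c d \<and> adj d a \<and> adj a c)"
    for a b c d
    using sat copies_diamond_iff[OF G, of "diamond_on a b c d"]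
    unfolding uniquely_saturated_def adj_def by blast
  have simple_add: "simple_graph (add_edge G u v)" if "u \<in> verts G" "v \<in> verts G" "u \<noteq> v" for u v
    using G that by (auto simp: simple_graph_def add_edge_def)
  define adj' where "adj' u v x y \<longleftrightarrow> {x, y} = {u, v} \<or> adj x y" for u v x y
  have edge_add: "{x, y} \<in> edges (add_edge G u v) \<longleftrightarrow> adj' u v x y" for u v x y
    by (simp add: add_edge_def adj'_def adj_def)
  have card1: "card (copies diamond (add_edge G u v)) = 1"
    if "u \<in> verts G" "v \<in> verts G" "u \<noteq> v" "\<not> adj u v" for u v
    using sat that unfolding uniquely_saturated_def adj_def by blast
  have copyI: "diamond_on a b c d \<in> copies diamond (add_edge G u v)"
    if "u \<in> verts G" "v \<in> verts G" "u \<noteq> v" "distinct [a, b, c, d]"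
      "adj' u v a b" "adj' u v b c" "adj' u v c d" "adj' u v d a" "adj' u v a c" for a b c d u v
    unfolding copies_diamond_iff[OF simple_add[OF that(1-3)]]
    by (rule exI[of _ a], rule exI[of _ b], rule exI[of _ c], rule exI[of _ d])
      (use that(4-) in \<open>simp add: edge_add\<close>)
  have uniq: "S = S'" if "u \<in> verts G" "v \<in> verts G" "u \<noteq> v" "\<not> adj u v"
    "S \<in> copies diamond (add_edge G u v)" "S' \<in> copies diamond (add_edge G u v)" for u v S S'
    using card1[OF that(1-4)] that(5,6) by (metis card_1_singletonE singletonD)
  have sat_ex: "\<exists>x. adj u x \<and> adj x v \<and>
        ((\<exists>y. y \<noteq> x \<and> adj u y \<and> adj y v) \<or> (\<exists>p. adj u p \<and> adj x p) \<or> (\<exists>q. adj v q \<and> adj x q))"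
    if uv: "u \<in> verts G" "v \<in> verts G" "u \<noteq> v" "\<not> adj u v" for u v
  proof -
    obtain S where "S \<in> copies diamond (add_edge G u v)"
      using card1[OF uv] by (metis card_1_singletonE singletonI)
    then obtain a b c d where d: "distinct [a, b, c, d]"
      "{{a, b}, {b, c}, {c, d}, {d, a}, {a, c}} \<subseteq> edges (add_edge G u v)"
      unfolding copies_diamond_iff[OF simple_add[OF uv(1-3)]]
      by (elim exE conjE) (rule that)
    then have e: "adj' u v a b" "adj' u v b c" "adj' u v c d" "adj' u v d a" "adj' u v a c"
      by (simp_all add: edge_add)
    \<comment> \<open>The new edge \<open>st\<close> is on the rim, \<open>sx\<close> is the chord
      and \<open>p\<close> the fourth vertex. Which of \<open>u\<close>, \<open>v\<close> is the
      chord end \<open>s\<close> is left open.\<close>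
    have rim: ?thesis if "{s, t} = {u, v}" "adj s x" "adj x t" "adj s p" "adj x p" for s t x p
    proof -
      have "(s = u \<and> t = v) \<or> (s = v \<and> t = u)" using that(1) by (auto simp: doubleton_eq_iff)
      then show ?thesis
      proof (elim disjE conjE)
        assume "s = u" "t = v"
        then show ?thesis using that(2-) by (intro exI[of _ x]) blast
      next
        assume "s = v" "t = u"
        then show ?thesis using that(2-) sym by (intro exI[of _ x]) blast
      qed
    qed
    have old: "adj s t" if "adj' u v s t" "{s', t'} = {u, v}" "{s, t} \<noteq> {s', t'}" for s t s' t'
      using that by (auto simp: adj'_def)
    \<comment> \<open>As \<open>G\<close> has no diamond, one of the five edges is the new one; the
      other four are then old.\<close>
    consider "{a, b} = {u, v}" | "{b, c} = {u, v}" | "{c, d} = {u, v}" | "{d, a} = {u, v}"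
      | "{a, c} = {u, v}"
      using none[of a b c d] d(1) e unfolding adj'_def by argo
    then show ?thesis
    proof cases
      case 1
      note o = old[OF _ 1]
      have "adj a c" "adj b c" "adj a d" "adj c d"
        using o[OF e(5)] o[OF e(2)] o[OF e(4)] o[OF e(3)] d(1) sym by (auto simp: doubleton_eq_iff)
      then show ?thesis using rim[OF 1, of c d] sym by blast
    next
      case 2
      note o = old[OF _ 2]
      have "adj a c" "adj a b" "adj a d" "adj c d"
        using o[OF e(5)] o[OF e(1)] o[OF e(4)] o[OF e(3)] d(1) sym by (auto simp: doubleton_eq_iff)
      then show ?thesis using rim[of c b a d] 2 sym by (simp add: insert_commute)
    next
      case 3
      note o = old[OF _ 3]
      have "adj a c" "adj a b" "adj a d" "adj b c"
        using o[OF e(5)] o[OF e(1)] o[OF e(4)] o[OF e(2)] d(1) sym by (auto simp: doubleton_eq_iff)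
      then show ?thesis using rim[OF 3, of a b] sym by blast
    next
      case 4
      note o = old[OF _ 4]
      have "adj a c" "adj a b" "adj c d" "adj b c"
        using o[OF e(5)] o[OF e(1)] o[OF e(3)] o[OF e(2)] d(1) sym by (auto simp: doubleton_eq_iff)
      then show ?thesis using rim[of a d c b] 4 sym by (simp add: insert_commute)
    next
      case 5
      note o = old[OF _ 5]
      have "adj a d" "adj a b" "adj c d" "adj b c"
        using o[OF e(4)] o[OF e(1)] o[OF e(3)] o[OF e(2)] d(1) sym by (auto simp: doubleton_eq_iff)
      then have "adj u b" "adj b v" "adj u d" "adj d v" "d \<noteq> b"
        using 5 d(1) sym by (auto simp: doubleton_eq_iff)
      then show ?thesis by blast
    qed
  qed
  show ?thesis unfolding adj_def[symmetric]
  proof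
    show "finite (verts G)" using G by (simp add: simple_graph_def)
    show "adj u v \<Longrightarrow> u \<in> verts G" "adj u v \<Longrightarrow> adj v u" "\<not> adj u u" for u v
      using inV sym irr by blast+
    show "u = v" if "adj x y" "adj x u" "adj y u" "adj x v" "adj y v" for x y u v
      using none[of x u y v] that sym irr by auto
    show "\<exists>x. adj u x \<and> adj x v \<and>
        ((\<exists>y. y \<noteq> x \<and> adj u y \<and> adj y v) \<or> (\<exists>p. adj u p \<and> adj x p) \<or> (\<exists>q. adj v q \<and> adj x q))"
      if "u \<in> verts G" "v \<in> verts G" "u \<noteq> v" "\<not> adj u v" for u v
      using that by (rule sat_ex)
    show "x = y \<or> y = z \<or> x = z"
      if uv: "u \<noteq> v" "\<not> adj u v" and a: "adj u x" "adj x v" "adj u y" "adj y v" "adj u z" "adj z v"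
      for u v x y z
    proof (rule ccontr)
      assume n: "\<not> ?thesis"
      have V: "u \<in> verts G" "v \<in> verts G" using a inV sym by blast+
      have ne: "x \<noteq> u" "x \<noteq> v" "y \<noteq> u" "y \<noteq> v" "z \<noteq> u" "z \<noteq> v" using a irr by auto
      have eq: "diamond_on u x v y = diamond_on u x v z"
        using uv ne n a sym
        by (intro uniq[OF V uv] copyI[OF V uv(1)]) (auto simp: adj'_def)
      have "y \<in> verts (diamond_on u x v y)" by (simp add: diamond_on_def)
      then have "y \<in> verts (diamond_on u x v z)" by (simp only: eq)
      then show False using n ne by (auto simp: diamond_on_def)
    qed
    show "x = y"
      if uv: "u \<noteq> v" "\<not> adj u v" and a: "adj u x" "adj x v" "adj u p" "adj x p" "adj u y" "adj y v"
      for u v x p y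
    proof (rule ccontr)
      assume n: "x \<noteq> y"
      have V: "u \<in> verts G" "v \<in> verts G" using a inV sym by blast+
      have ne: "x \<noteq> u" "x \<noteq> v" "y \<noteq> u" "y \<noteq> v" "p \<noteq> u" "p \<noteq> x" "p \<noteq> v" using a uv irr by auto
      have eq: "diamond_on u x v y = diamond_on u v x p"
        using uv ne n a sym
        by (intro uniq[OF V uv] copyI[OF V uv(1)]) (auto simp: adj'_def)
      \<comment> \<open>The case \<open>p = y\<close>, with equal vertex sets, has not been
        excluded, so an edge separates the two diamonds.\<close>
      have "{x, p} \<in> edges (diamond_on u v x p)" by (simp add: diamond_on_def)
      then have "{x, p} \<in> edges (diamond_on u x v y)" by (simp only: eq)
      then show False using ne by (auto simp: diamond_on_def doubleton_eq_iff)
    qed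
    show False
      if uv: "u \<noteq> v" "\<not> adj u v" and a: "adj u x" "adj x v" "adj u p" "adj x p" "adj v q" "adj x q"
      for u v x p q
    proof -
      have V: "u \<in> verts G" "v \<in> verts G" using a inV sym by blast+
      have ne: "x \<noteq> u" "x \<noteq> v" "p \<noteq> u" "p \<noteq> x" "p \<noteq> v" "q \<noteq> u" "q \<noteq> x" "q \<noteq> v"
        using a uv irr sym by auto
      have eq: "diamond_on u v x p = diamond_on v u x q"
        using uv ne a sym
        by (intro uniq[OF V uv] copyI[OF V uv(1)]) (auto simp: adj'_def)
      \<comment> \<open>Again by an edge: in the second diamond \<open>u\<close> is off the chord
        and adjacent only to \<open>v\<close> and \<open>x\<close>.\<close>
      have "{u, p} \<in> edges (diamond_on u v x p)" by (simp add: diamond_on_def insert_commute)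
      then have "{u, p} \<in> edges (diamond_on v u x q)" by (simp only: eq)
      then show False using ne uv by (auto simp: diamond_on_def doubleton_eq_iff)
    qed
  qed
qed

section \<open>Counting copies of \<open>K3\<close>\<close>

text \<open>\<open>verts\<close> maps the copies of \<open>K3\<close> bijectively to
  \<open>triangles\<close>, because a copy contains all pairs of its vertices as edges.\<close>

lemma card_copies_K3_not_2_or_3:
  fixes G :: "'a graph"
  assumes G: "simple_graph G" and sat: "uniquely_saturated diamond G"
  shows "card (copies K3 G) \<noteq> 2 \<and> card (copies K3 G) \<noteq> 3"
proof -
  interpret diamond_saturated "verts G" "\<lambda>u v. {u, v} \<in> edges G"
    using uniquely_saturated_imp_locale[OF assms] .
  have "distinct [a, b, c] \<and> {{a, b}, {b, c}, {c, a}} \<subseteq> edges G \<longleftrightarrow> triangle a b c" for a b c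
    using triangle_distinct[of a b c] by (auto simp: triangle_def insert_commute)
  then have K: "S \<in> copies K3 G \<longleftrightarrow> (\<exists>a b c. S = triangle_on a b c \<and> triangle a b c)" for S
    unfolding copies_K3_iff[OF G] by metis
  have verts_triangle: "verts (triangle_on a b c) = {a, b, c}" for a b c :: 'a
    by (simp add: triangle_on_def)
  have "verts ` copies K3 G = triangles"
  proof (intro equalityI subsetI)
    fix T assume "T \<in> verts ` copies K3 G"
    then obtain S where S: "S \<in> copies K3 G" "T = verts S" by blast
    from S(1) obtain a b c where "S = triangle_on a b c" "triangle a b c"
      unfolding K by (elim exE conjE) (rule that)
    then show "T \<in> triangles" using S(2) verts_triangle unfolding triangles_def by blast
  next
    fix T assume "T \<in> triangles"
    then obtain a b c where abc: "triangle a b c" "T = {a, b, c}" unfolding triangles_def by blast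
    then have "triangle_on a b c \<in> copies K3 G" unfolding K by blast
    then show "T \<in> verts ` copies K3 G"
      unfolding abc(2) verts_triangle[symmetric] by (rule imageI)
  qed
  moreover have "inj_on verts (copies K3 G)"
  proof (rule inj_onI)
    have all_pairs: "edges S = {e. e \<subseteq> verts S \<and> card e = 2}" if "S \<in> copies K3 G" for S
    proof -
      from that obtain a b c where abc: "S = triangle_on a b c" "triangle a b c"
        unfolding K by (elim exE conjE) (rule that)
      show ?thesis unfolding abc(1)
        by (rule edges_triangle_on) (use triangle_distinct[OF abc(2)] in simp_all)
    qed
    fix S S' assume "S \<in> copies K3 G" "S' \<in> copies K3 G" "verts S = verts S'"
    then show "S = S'" using all_pairs[of S] all_pairs[of S'] by (simp add: prod_eq_iff)
  qed
  ultimately have "card (copies K3 G) = card triangles"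
    by (metis card_image)
  then show ?thesis using card_triangles by auto
qed

theorem theorem3p7:
  shows "\<not> (\<exists>G :: 'a graph. simple_graph G \<and> uniquely_saturated diamond G \<and>
              card (copies K3 G) = 2) \<and>
         \<not> (\<exists>G :: 'a graph. simple_graph G \<and> uniquely_saturated diamond G \<and>
              card (copies K3 G) = 3)"
  using card_copies_K3_not_2_or_3 by blast

end
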